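(* Let $\Gamma$ be a tree on the vertex set $[m+1]$, $m\ge 1$. Then $$I(\Gamma)=\bigcap_{1\leq i<j\leq m+1}(x_{i\,b(i,j)},\,x_{j\,e(i,j)}).$$
   Context: $[m+1]=\{1,\dots,m+1\}$. Let $K$ be a field, and for each edge $\{i,j\}$ of $\Gamma$ let $x_{ij}$ and $x_{ji}$ be two distinct indeterminates; all these indeterminates (two per edge) are distinct and we work in the polynomial ring over $K$ in them. Fix an arbitrary ordering of the $m$ edges of $\Gamma$. The $m\times(m+1)$ matrix $A(\Gamma)=(a_{kl})$ is defined as follows: if the $k$th edge is $\{i,j\}$ with $i<j$, then $a_{ki}=-x_{ij}$, $a_{kj}=x_{ji}$, and $a_{kl}=0$ for $l\ne i,j$. Let $v_j$ be the minor of $A(\Gamma)$ obtained by omitting the $j$th column. $I(\Gamma)$ is the ideal generated by $v_1,\dots,v_{m+1}$ (the generic monomial ideal attached to $\Gamma$). For distinct vertices $i,j$ of $\Gamma$, let $i=i_0,i_1,\dots,i_{k-1},i_k=j$ be the unique path in $\Gamma$ from $i$ to $j$; set $b(i,j)=i_1$ and $e(i,j)=i_{k-1}$. *)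

theory Defs
  imports
    "Jordan_Normal_Form.DL_Submatrix"
    "Jordan_Normal_Form.Determinant"
    "HOL-Algebra.Ideal"
    "HOL-Library.Poly_Mapping"
begin

section \<open>Trees\<close>

text \<open>
  A simple graph is a vertex set together with a set \<open>E\<close> of two-element subsets of it. Paths and
  cycles are lists of vertices; the closing edge of a cycle joins its last vertex to its first.
\<close>

definition simple_graph :: "'v set \<Rightarrow> 'v set set \<Rightarrow> bool" where
  "simple_graph V E \<longleftrightarrow> finite V \<and> (\<forall>e\<in>E. e \<subseteq> V \<and> card e = 2)"

definition path_between :: "'v set set \<Rightarrow> 'v \<Rightarrow> 'v \<Rightarrow> 'v list \<Rightarrow> bool" where
  "path_between E u v p \<longleftrightarrow>
     p \<noteq> [] \<and> hd p = u \<and> last p = v \<and> distinct p \<and> successively (\<lambda>x y. {x, y} \<in> E) p"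

definition graph_cycle :: "'v set set \<Rightarrow> 'v list \<Rightarrow> bool" where
  "graph_cycle E p \<longleftrightarrow>
     3 \<le> length p \<and> distinct p \<and> successively (\<lambda>x y. {x, y} \<in> E) p \<and> {last p, hd p} \<in> E"

definition is_tree :: "'v set \<Rightarrow> 'v set set \<Rightarrow> bool" where
  "is_tree V E \<longleftrightarrow>
     simple_graph V E \<and> V \<noteq> {} \<and>
     (\<forall>u\<in>V. \<forall>v\<in>V. \<exists>p. path_between E u v p) \<and>
     (\<nexists>p. graph_cycle E p)"

text \<open>
  For distinct vertices \<open>i\<close>, \<open>j\<close> of a tree the path \<open>i = i\<^sub>0, \<dots>, i\<^sub>k = j\<close> exists and is unique;
  \<open>tree_b\<close> is the vertex following \<open>i\<close> and \<open>tree_e\<close> the vertex preceding \<open>j\<close> on it. The list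
  representing the path has length \<open>k + 1\<close>.
\<close>

definition tree_path :: "'v set set \<Rightarrow> 'v \<Rightarrow> 'v \<Rightarrow> 'v list" where
  "tree_path E i j = (THE p. path_between E i j p)"

definition tree_b :: "'v set set \<Rightarrow> 'v \<Rightarrow> 'v \<Rightarrow> 'v" where
  "tree_b E i j = tree_path E i j ! 1"

definition tree_e :: "'v set set \<Rightarrow> 'v \<Rightarrow> 'v \<Rightarrow> 'v" where
  "tree_e E i j = tree_path E i j ! (length (tree_path E i j) - 2)"


section \<open>The polynomial ring in the indeterminates $x_{ij}$\<close>

text \<open>
  A monomial is a finitely supported exponent function on pairs \<open>(i, j)\<close>, the pair \<open>(i, j)\<close>
  standing for the indeterminate $x_{ij}$. The type has an indeterminate for every pair; the ring
  \<open>edge_poly_ring E\<close> only contains the polynomials in the $x_{ij}$ with \<open>{i, j} \<in> E\<close>, two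
  indeterminates per edge.
\<close>

type_synonym 'a edge_poly = "((nat \<times> nat) \<Rightarrow>\<^sub>0 nat) \<Rightarrow>\<^sub>0 'a"

definition X :: "nat \<Rightarrow> nat \<Rightarrow> 'a::field edge_poly" where
  "X i j = Poly_Mapping.single (Poly_Mapping.single (i, j) 1) 1"

definition edge_poly_ring :: "nat set set \<Rightarrow> 'a::field edge_poly ring" where
  "edge_poly_ring E =
     \<lparr>carrier = {p. \<forall>t \<in> Poly_Mapping.keys p. \<forall>(i, j) \<in> Poly_Mapping.keys t. {i, j} \<in> E},
      mult = (*), one = 1, zero = 0, add = (+)\<rparr>"

lemma X_in_edge_poly_ring: "{i, j} \<in> E \<Longrightarrow> X i j \<in> carrier (edge_poly_ring E)"
  by (simp add: edge_poly_ring_def X_def)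

lemma edge_poly_ring_cring: "cring (edge_poly_ring E :: 'a::field edge_poly ring)"
proof -
  let ?R = "edge_poly_ring E :: 'a edge_poly ring"
  have mem: "p \<in> carrier ?R \<longleftrightarrow>
      (\<forall>t i j. t \<in> Poly_Mapping.keys p \<longrightarrow> (i, j) \<in> Poly_Mapping.keys t \<longrightarrow> {i, j} \<in> E)" for p
    by (auto simp: edge_poly_ring_def)
  have ops [simp]: "add ?R = (+)" "zero ?R = 0" "mult ?R = (*)" "one ?R = 1"
    by (simp_all add: edge_poly_ring_def)
  have add: "p + q \<in> carrier ?R" if "p \<in> carrier ?R" "q \<in> carrier ?R" for p q
    using that Poly_Mapping.keys_add[of p q] unfolding mem by blast
  have mult: "p * q \<in> carrier ?R" if p: "p \<in> carrier ?R" and q: "q \<in> carrier ?R" for p q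
    unfolding mem
  proof (intro allI impI)
    fix t i j
    assume t: "t \<in> Poly_Mapping.keys (p * q)" and ij: "(i, j) \<in> Poly_Mapping.keys t"
    from t obtain a b
      where ab: "t = a + b" "a \<in> Poly_Mapping.keys p" "b \<in> Poly_Mapping.keys q"
      using Poly_Mapping.keys_mult[of p q] by blast
    with ij have "(i, j) \<in> Poly_Mapping.keys a \<or> (i, j) \<in> Poly_Mapping.keys b"
      using Poly_Mapping.keys_add[of a b] by blast
    with ab p q show "{i, j} \<in> E"
      unfolding mem by blast
  qed
  have inv: "\<exists>q\<in>carrier ?R. q + p = 0" if "p \<in> carrier ?R" for p
    using that by (intro bexI[of _ "- p"]) (simp_all add: mem)
  have zero: "0 \<in> carrier ?R" and one: "1 \<in> carrier ?R"
    by (simp_all add: mem)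
  show ?thesis
  proof (rule cringI)
    show "abelian_group ?R"
      by (rule abelian_groupI) (use add zero inv in \<open>simp_all add: add_ac\<close>)
    show "comm_monoid ?R"
      by (rule comm_monoidI) (use mult one in \<open>simp_all add: mult_ac\<close>)
  qed (simp add: distrib_right)
qed


section \<open>The generic monomial ideal of a tree\<close>

text \<open>
  The list \<open>es\<close> is the chosen ordering of the edges of a tree on \<open>{1..m + 1}\<close>, so its length is
  \<open>m\<close>. Matrix indices start at 0: row \<open>k\<close> belongs to the edge \<open>es ! k\<close>, and the column of the
  vertex \<open>j\<close> has index \<open>j - 1\<close>.
\<close>

definition tree_mat :: "nat \<Rightarrow> nat set list \<Rightarrow> 'a::field edge_poly mat" where
  "tree_mat m es = mat m (m + 1) (\<lambda>(k, l).
     let i = Min (es ! k); j = Max (es ! k) in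
     if l + 1 = i then - X i j else if l + 1 = j then X j i else 0)"

definition tree_minor :: "nat \<Rightarrow> nat set list \<Rightarrow> nat \<Rightarrow> 'a::field edge_poly" where
  "tree_minor m es j = det (submatrix (tree_mat m es) UNIV (- {j - 1}))"

definition generic_monomial_ideal :: "nat \<Rightarrow> nat set list \<Rightarrow> 'a::field edge_poly set" where
  "generic_monomial_ideal m es =
     genideal (edge_poly_ring (set es)) (tree_minor m es ` {1..m + 1})"

end

theory Submission
  imports Defs
begin

text \<open>
  All ideals involved turn out to be generated by single terms, so the theorem reduces to a
  statement about which indeterminates divide a monomial. Write \<open>b(i, j)\<close> for the neighbour of
  \<open>i\<close> towards \<open>j\<close>; reversing paths gives \<open>e(i, j) = b(j, i)\<close>.

  \<^emph>\<open>The minors.\<close> A nonzero term in the expansion of the minor \<open>v\<^sub>r\<close> matches the edges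
  bijectively with the vertices other than \<open>r\<close>, each edge with one of its endpoints. Root the
  tree at \<open>r\<close>: an edge at \<open>r\<close> can only be matched with its other endpoint, and going outwards
  every edge is forced to be matched with the endpoint farther from \<open>r\<close>
  (\<open>edge_matching_unique\<close>). So exactly one permutation survives, and
  \<open>v\<^sub>r\<close> is, up to sign, the product of the \<open>x\<^bsub>i b(i, r)\<^esub>\<close> over all \<open>i \<noteq> r\<close> (\<open>tree_minor_eq_term\<close>).

  \<^emph>\<open>Ideals generated by terms.\<close> A polynomial lies in such an ideal iff each of its
  monomials is divisible by a generator (\<open>genideal_terms\<close>). Hence it suffices to show, for the set
  \<open>S\<close> of pairs \<open>(x, y)\<close> with \<open>x\<^bsub>xy\<^esub>\<close> dividing a given monomial, that some root \<open>r\<close> satisfies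
  \<open>(i, b(i, r)) \<in> S\<close> for all \<open>i \<noteq> r\<close> iff for any two vertices \<open>i\<close>, \<open>j\<close> one of \<open>(i, b(i, j))\<close>,
  \<open>(j, b(j, i))\<close> is in \<open>S\<close>.

  \<^emph>\<open>The combinatorial core\<close> (\<open>common_root_iff\<close>). Every directed edge \<open>(i, k)\<close> missing from \<open>S\<close>
  forces the root to lie in the part of the tree containing \<open>i\<close> that is left when the edge
  is cut. The condition on pairs says that these subtrees meet pairwise, and then an inclusion-minimal
  one is cut off at a vertex that belongs to all of them, a Helly property of
  subtrees.
\<close>

section \<open>Paths and branches in trees\<close>

text \<open>
  This is the only use of acyclicity: if the two paths met, following one of them to the first meeting
  vertex and returning along the other would close a cycle. Uniqueness of paths and the
  behaviour of branches at a vertex are both consequences.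
\<close>

lemma diverging_paths_disjoint:
  assumes acyclic: "\<nexists>c. graph_cycle E c"
    and p: "distinct (u # p)" "successively (\<lambda>x y. {x, y} \<in> E) (u # p)"
    and q: "distinct (u # q)" "successively (\<lambda>x y. {x, y} \<in> E) (u # q)"
    and diverge: "p \<noteq> []" "q \<noteq> []" "hd p \<noteq> hd q"
  shows "set p \<inter> set q = {}"
proof (rule ccontr)
  assume "set p \<inter> set q \<noteq> {}"
  then have "\<exists>w\<in>set p. w \<in> set q" by auto
  then obtain p1 w p2 where ps: "p = p1 @ w # p2" "w \<in> set q" "\<forall>y\<in>set p1. y \<notin> set q"
    using split_list_first_prop[of p "\<lambda>w. w \<in> set q"] by blast
  then obtain q1 q2 where qs: "q = q1 @ w # q2"
    using split_list by metis
  (* The candidate cycle is u, p1, w, rev q1. If both p1 and q1 were empty, then p and q would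
     both start with w; this is what rules out a degenerate cycle of length 2. *)
  have "p1 \<noteq> [] \<or> q1 \<noteq> []"
    using diverge(3) ps(1) qs by auto
  then have "3 \<le> length (u # p1 @ w # rev q1)"
    by (auto simp: neq_Nil_conv)
  moreover have "distinct (u # p1 @ w # rev q1)"
    using p(1) q(1) ps qs by auto
  moreover have "successively (\<lambda>x y. {x, y} \<in> E) (u # p1 @ w # rev q1)"
  proof -
    have "successively (\<lambda>x y. {x, y} \<in> E) ((u # p1) @ [w] @ p2)"
      using p(2) ps(1) by simp
    then have 1: "successively (\<lambda>x y. {x, y} \<in> E) ((u # p1) @ [w])"
      by (auto simp: successively_append_iff simp del: append_Cons)
    have "successively (\<lambda>x y. {x, y} \<in> E) ((u # q1 @ [w]) @ q2)"
      using q(2) qs by simp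
    then have "successively (\<lambda>x y. {x, y} \<in> E) (u # q1 @ [w])"
      unfolding successively_append_iff by blast
    then have "successively (\<lambda>x y. {x, y} \<in> E) (q1 @ [w])"
      by (auto simp: successively_Cons)
    then have "successively (\<lambda>x y. {x, y} \<in> E) (rev (q1 @ [w]))"
      unfolding successively_rev by (simp add: insert_commute)
    then have 2: "successively (\<lambda>x y. {x, y} \<in> E) (w # rev q1)"
      by simp
    have "successively (\<lambda>x y. {x, y} \<in> E) ((u # p1) @ (w # rev q1))"
      using 1 2 by (auto simp: successively_append_iff simp del: append_Cons)
    then show ?thesis by simp
  qed
  moreover have "{last (u # p1 @ w # rev q1), hd (u # p1 @ w # rev q1)} \<in> E"
  proof -
    have "last (u # p1 @ w # rev q1) = hd q"
      using qs by (cases q1) auto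
    moreover have "{u, hd q} \<in> E"
      using q(2) diverge(2) by (cases q) auto
    ultimately show ?thesis by (simp add: insert_commute)
  qed
  ultimately have "graph_cycle E (u # p1 @ w # rev q1)"
    unfolding graph_cycle_def by blast
  with acyclic show False by blast
qed

lemma path_between_rev:
  "path_between E u v p \<Longrightarrow> path_between E v u (rev p)"
  by (auto simp: path_between_def hd_rev last_rev insert_commute)

lemma path_between_tl:
  assumes "path_between E u v (u # x # p)"
  shows "path_between E x v (x # p)"
  using assms by (auto simp: path_between_def)

lemma path_between_unique:
  assumes acyclic: "\<nexists>c. graph_cycle E c"
    and "path_between E u v p" "path_between E u v q"
  shows "p = q"
  using assms(2,3)
proof (induction p arbitrary: u q)
  case Nil
  then show ?case by (simp add: path_between_def)
next
  case (Cons a p)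
  then have [simp]: "a = u" by (simp add: path_between_def)
  from Cons.prems obtain q' where q: "q = u # q'"
    by (cases q) (auto simp: path_between_def)
  show ?case
  proof (cases "p = [] \<or> q' = []")
    case True
    with Cons.prems q show ?thesis
      by (auto simp: path_between_def split: if_splits)
  next
    case False
    then obtain x ps y qs where ps: "p = x # ps" and qs: "q' = y # qs"
      by (auto simp: neq_Nil_conv)
    have "x = y"
    proof (rule ccontr)
      assume "x \<noteq> y"
      then have "set p \<inter> set q' = {}"
        using diverging_paths_disjoint[OF acyclic, of u p q'] Cons.prems q ps qs
        by (auto simp: path_between_def)
      moreover have "v \<in> set p" "v \<in> set q'"
        using Cons.prems q ps qs last_in_set[of p] last_in_set[of q']
        by (auto simp: path_between_def)
      ultimately show False by blast
    qed
    then have "p = q'"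
      using Cons.IH[of x q'] Cons.prems path_between_tl ps qs q by (metis \<open>a = u\<close>)
    with q show ?thesis by simp
  qed
qed

locale finite_tree =
  fixes V :: "'v set" and E :: "'v set set"
  assumes tree: "is_tree V E"
begin

lemma nonempty: "V \<noteq> {}" and acyclic: "\<nexists>c. graph_cycle E c" and finite_vertices: "finite V"
  and edge_subset: "e \<in> E \<Longrightarrow> e \<subseteq> V" and edge_card: "e \<in> E \<Longrightarrow> card e = 2"
  using tree by (auto simp: is_tree_def simple_graph_def)

lemma edge_neq: "{x, y} \<in> E \<Longrightarrow> x \<noteq> y"
  using edge_card[of "{x, y}"] by auto

lemma edge_vertices: "{x, y} \<in> E \<Longrightarrow> x \<in> V" "{x, y} \<in> E \<Longrightarrow> y \<in> V"
  using edge_subset by blast+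

lemma tree_path_eq:
  assumes "path_between E u v p"
  shows "tree_path E u v = p"
  unfolding tree_path_def
  using path_between_unique[OF acyclic] assms by (intro the_equality)

lemma path_between_tree_path:
  assumes "u \<in> V" "v \<in> V"
  shows "path_between E u v (tree_path E u v)"
proof -
  have "\<exists>p. path_between E u v p"
    using tree assms unfolding is_tree_def by blast
  then show ?thesis using tree_path_eq by metis
qed

lemma tree_path_Cons:
  assumes "u \<in> V" "v \<in> V" "u \<noteq> v"
  obtains p where "tree_path E u v = u # tree_b E u v # p"
proof -
  obtain q where q: "tree_path E u v = u # q"
    using path_between_tree_path[OF assms(1,2)]
    by (cases "tree_path E u v") (auto simp: path_between_def)
  then obtain x p where "tree_path E u v = u # x # p"
    using path_between_tree_path[OF assms(1,2)] assms(3)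
    by (cases q) (auto simp: path_between_def)
  then show ?thesis using that by (auto simp: tree_b_def)
qed

lemma tree_e_eq_tree_b:
  assumes "u \<in> V" "v \<in> V" "u \<noteq> v"
  shows "tree_e E u v = tree_b E v u"
proof -
  obtain p where p: "tree_path E v u = v # tree_b E v u # p"
    using tree_path_Cons assms by metis
  have "tree_path E u v = rev (tree_path E v u)"
    using tree_path_eq[OF path_between_rev[OF path_between_tree_path[OF assms(2,1)]]] .
  with p show ?thesis by (simp add: tree_e_def nth_append)
qed

lemma tree_b_edge:
  assumes "u \<in> V" "v \<in> V" "u \<noteq> v"
  shows "{u, tree_b E u v} \<in> E"
proof -
  obtain p where "tree_path E u v = u # tree_b E u v # p"
    using tree_path_Cons assms by metis
  then show ?thesis
    using path_between_tree_path[OF assms(1,2)] by (simp add: path_between_def)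
qed

lemma tree_b_adjacent:
  assumes "{u, v} \<in> E"
  shows "tree_b E u v = v"
proof -
  have "path_between E u v [u, v]"
    using assms edge_neq by (auto simp: path_between_def)
  from tree_path_eq[OF this] show ?thesis by (simp add: tree_b_def)
qed

lemma length_tree_path_tree_b:
  assumes "u \<in> V" "v \<in> V" "u \<noteq> v"
  shows "length (tree_path E (tree_b E u v) v) < length (tree_path E u v)"
proof -
  obtain p where p: "tree_path E u v = u # tree_b E u v # p"
    using tree_path_Cons assms by metis
  then have "path_between E (tree_b E u v) v (tree_b E u v # p)"
    using path_between_tl path_between_tree_path[OF assms(1,2)] by metis
  from tree_path_eq[OF this] p show ?thesis by simp
qed

text \<open>
  If the path from \<open>j\<close> to \<open>v\<close> leaves \<open>j\<close> by a different edge than the path from \<open>j\<close> to \<open>i\<close>, the two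
  paths concatenate to the path from \<open>i\<close> to \<open>v\<close>, so that \<open>i\<close> sees \<open>v\<close> and \<open>j\<close> in the same direction.
  All later facts about directions in the tree rest on this.
\<close>
lemma tree_b_through:
  assumes V: "i \<in> V" "j \<in> V" "v \<in> V" and "j \<noteq> i" "j \<noteq> v"
    and branch: "tree_b E j v \<noteq> tree_b E j i"
  shows "tree_b E i v = tree_b E i j"
proof -
  obtain p where p: "tree_path E j i = j # tree_b E j i # p"
    using tree_path_Cons assms by metis
  obtain q where q: "tree_path E j v = j # tree_b E j v # q"
    using tree_path_Cons assms by metis
  have pp: "path_between E j i (j # tree_b E j i # p)"
    and pq: "path_between E j v (j # tree_b E j v # q)"
    using p q path_between_tree_path V by metis+
  have "set (tree_b E j i # p) \<inter> set (tree_b E j v # q) = {}"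
    using diverging_paths_disjoint[OF acyclic, of j "tree_b E j i # p" "tree_b E j v # q"] pp pq branch
    by (auto simp: path_between_def)
  moreover have rev: "path_between E i j (rev p @ [tree_b E j i, j])"
    using path_between_rev[OF pp] by simp
  ultimately have "path_between E i v ((rev p @ [tree_b E j i, j]) @ tree_b E j v # q)"
    using pq unfolding path_between_def successively_append_iff
    by (auto simp: hd_append)
  from tree_path_eq[OF this] tree_path_eq[OF rev] show ?thesis
    unfolding tree_b_def by (cases "rev p") (simp_all add: nth_append)
qed

lemma edge_towards_root:
  assumes e: "{x, y} \<in> E" and "r \<in> V"
  shows "x \<noteq> r \<and> tree_b E x r = y \<or> y \<noteq> r \<and> tree_b E y r = x"
proof (cases "x = r")
  case True
  then show ?thesis
    using e edge_neq tree_b_adjacent[of y x] by (auto simp: insert_commute)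
next
  case False
  then show ?thesis
    using tree_b_through[of y x r] edge_vertices[OF e] edge_neq[OF e] tree_b_adjacent[of x y]
      tree_b_adjacent[of y x] e \<open>r \<in> V\<close> by (metis insert_commute)
qed

text \<open>
  Two vertices with the same parent edge would each be the parent of the other, although passing to
  the parent strictly decreases the distance to the root.
\<close>
lemma parent_edge_inj:
  assumes r: "r \<in> V" and i: "i \<in> V - {r}" and j: "j \<in> V - {r}"
    and eq: "{i, tree_b E i r} = {j, tree_b E j r}"
  shows "i = j"
proof (rule ccontr)
  assume "i \<noteq> j"
  with eq have "tree_b E i r = j" "tree_b E j r = i"
    by (auto simp: doubleton_eq_iff)
  then show False
    using length_tree_path_tree_b[of i r] length_tree_path_tree_b[of j r] i j r by auto
qed

lemma bij_betw_parent_edge: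
  assumes r: "r \<in> V"
  shows "bij_betw (\<lambda>i. {i, tree_b E i r}) (V - {r}) E"
  unfolding bij_betw_def
proof
  show "inj_on (\<lambda>i. {i, tree_b E i r}) (V - {r})"
    using parent_edge_inj[OF r] by (intro inj_onI)
  have "e \<in> (\<lambda>i. {i, tree_b E i r}) ` (V - {r})" if e': "e \<in> E" for e
  proof -
    obtain x y where e: "e = {x, y}"
      using edge_card[OF e'] by (metis card_2_iff)
    from edge_towards_root[of x y r] e e' r
    consider "x \<noteq> r" "tree_b E x r = y" | "y \<noteq> r" "tree_b E y r = x" by blast
    then show ?thesis
    proof cases
      case 1
      with e e' edge_vertices(1)[of x y] show ?thesis by (intro image_eqI[of _ _ x]) auto
    next
      case 2
      with e e' edge_vertices(2)[of x y] show ?thesis by (intro image_eqI[of _ _ y]) auto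
    qed
  qed
  moreover have "(\<lambda>i. {i, tree_b E i r}) ` (V - {r}) \<subseteq> E"
    using tree_b_edge[OF _ r] by blast
  ultimately show "(\<lambda>i. {i, tree_b E i r}) ` (V - {r}) = E"
    by blast
qed

text \<open>
  The edge from \<open>i\<close> to its parent \<open>k\<close> could only be assigned to \<open>k\<close> instead of \<open>i\<close>. But \<open>k\<close> is either
  the root, which is excluded, or closer to the root than \<open>i\<close> and by induction already used up by
  its own parent edge.
\<close>
lemma edge_matching_unique:
  assumes r: "r \<in> V" and g: "inj_on g E" "\<And>e. e \<in> E \<Longrightarrow> g e \<in> e - {r}"
    and i: "i \<in> V - {r}"
  shows "g {i, tree_b E i r} = i"
  using i
proof (induction "length (tree_path E i r)" arbitrary: i rule: less_induct)
  case (less i)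
  let ?k = "tree_b E i r"
  have e: "{i, ?k} \<in> E" using less.prems tree_b_edge r by auto
  show ?case
  proof (rule ccontr)
    assume "g {i, ?k} \<noteq> i"
    with g(2)[OF e] have k: "g {i, ?k} = ?k" "?k \<noteq> r" by auto
    have kV: "?k \<in> V - {r}" using k edge_vertices[OF e] by auto
    have "g {?k, tree_b E ?k r} = ?k"
      using less.hyps[of ?k] length_tree_path_tree_b[of i r] less.prems r kV by auto
    then have "{i, ?k} = {?k, tree_b E ?k r}"
      using k(1) e tree_b_edge[of ?k r] kV r by (intro inj_onD[OF g(1)]) simp_all
    then have "i = ?k"
      using parent_edge_inj[OF r less.prems kV] by simp
    with edge_neq[OF e] show False by simp
  qed
qed

text \<open>
  If \<open>r\<close> is a common root, then of two vertices \<open>i\<close> and \<open>j\<close> at least one sees \<open>r\<close> in the direction of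
  the other vertex. Conversely, call \<open>side (i, k)\<close> the part of the tree that contains \<open>i\<close> after
  cutting the edge between \<open>i\<close> and \<open>k\<close>. A directed edge \<open>(i, k) \<notin> S\<close> whose side is smallest
  provides the root \<open>i\<close>: if \<open>(j, b(j, i)) \<notin> S\<close> for some \<open>j\<close>, then the condition on pairs puts \<open>j\<close>
  on the side of \<open>(i, k)\<close>, and the side of \<open>(j, b(j, i))\<close> would be a proper part of it.
\<close>
lemma common_root_iff:
  "(\<exists>r\<in>V. \<forall>i\<in>V - {r}. (i, tree_b E i r) \<in> S) \<longleftrightarrow>
    (\<forall>i\<in>V. \<forall>j\<in>V. i \<noteq> j \<longrightarrow> (i, tree_b E i j) \<in> S \<or> (j, tree_b E j i) \<in> S)"
proof (intro iffI ballI impI)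
  fix i j
  assume "\<exists>r\<in>V. \<forall>i\<in>V - {r}. (i, tree_b E i r) \<in> S" and V: "i \<in> V" "j \<in> V" and "i \<noteq> j"
  then obtain r where r: "r \<in> V" "\<And>i. i \<in> V - {r} \<Longrightarrow> (i, tree_b E i r) \<in> S"
    by blast
  then show "(i, tree_b E i j) \<in> S \<or> (j, tree_b E j i) \<in> S"
    using V \<open>i \<noteq> j\<close> tree_b_through[of j i r] by (metis Diff_iff singletonD)
next
  assume pair: "\<forall>i\<in>V. \<forall>j\<in>V. i \<noteq> j \<longrightarrow> (i, tree_b E i j) \<in> S \<or> (j, tree_b E j i) \<in> S"
  define side where "side = (\<lambda>(i, k). {v \<in> V. v = i \<or> tree_b E i v \<noteq> k})"
  define D where "D = {(x, y). {x, y} \<in> E} - S"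
  show "\<exists>r\<in>V. \<forall>i\<in>V - {r}. (i, tree_b E i r) \<in> S"
  proof (cases "D = {}")
    case True
    (* No directed edge is missing, so any vertex serves as root. *)
    then show ?thesis using nonempty tree_b_edge by (fastforce simp: D_def)
  next
    case False
    obtain i k where ik: "(i, k) \<in> D" and min: "\<And>d. d \<in> D \<Longrightarrow> card (side (i, k)) \<le> card (side d)"
    proof -
      obtain d0 where "d0 \<in> D" using False by auto
      then obtain d where "d \<in> D" "\<And>d'. d' \<in> D \<Longrightarrow> card (side d) \<le> card (side d')"
        using ex_has_least_nat[of "\<lambda>d. d \<in> D" d0 "\<lambda>d. card (side d)"] by metis
      then show ?thesis using that by (cases d) auto
    qed
    then have i: "i \<in> V" "(i, k) \<notin> S" using edge_vertices by (auto simp: D_def)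
    have "(j, tree_b E j i) \<in> S" if j: "j \<in> V - {i}" for j
    proof (rule ccontr)
      assume nS: "(j, tree_b E j i) \<notin> S"
      then have jD: "(j, tree_b E j i) \<in> D"
        using j i tree_b_edge[of j i] by (auto simp: D_def)
      have ij: "tree_b E i j \<noteq> k"
        using pair j i nS by auto
      have "side (j, tree_b E j i) \<subset> side (i, k)"
      proof
        show "side (j, tree_b E j i) \<subseteq> side (i, k)"
        proof
          fix v assume "v \<in> side (j, tree_b E j i)"
          then have v: "v \<in> V" "v = j \<or> tree_b E j v \<noteq> tree_b E j i"
            by (auto simp: side_def)
          then have "tree_b E i v = tree_b E i j"
            using tree_b_through[of i j v] i j by blast
          then show "v \<in> side (i, k)"
            using v ij by (simp add: side_def)
        qed
        show "side (j, tree_b E j i) \<noteq> side (i, k)"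
          using i j by (auto simp: side_def)
      qed
      moreover have "finite (side (i, k))"
        using finite_vertices by (simp add: side_def)
      ultimately have "card (side (j, tree_b E j i)) < card (side (i, k))"
        by (rule psubset_card_mono[rotated])
      with min[OF jD] show False by simp
    qed
    with i show ?thesis by blast
  qed
qed

end

section \<open>Ideals generated by terms\<close>

text \<open>
  Monomials are written additively: this says that a squarefree monomial divides \<open>t\<close>
  iff each of its indeterminates does.
\<close>
lemma exists_add_sum_single_iff:
  fixes t :: "'v \<Rightarrow>\<^sub>0 nat"
  assumes "finite A" "inj_on f A"
  shows "(\<exists>u. t = (\<Sum>i\<in>A. Poly_Mapping.single (f i) 1) + u) \<longleftrightarrow> f ` A \<subseteq> Poly_Mapping.keys t"
proof -
  define s where "s = (\<Sum>i\<in>A. Poly_Mapping.single (f i) (1 :: nat))"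
  have lookup_s: "Poly_Mapping.lookup s x = (if x \<in> f ` A then 1 else 0)" for x
  proof -
    have "Poly_Mapping.lookup s x = (\<Sum>i\<in>A. if f i = x then 1 else 0)"
      unfolding s_def lookup_sum lookup_single when_def ..
    also have "\<dots> = (\<Sum>y\<in>f ` A. if y = x then 1 else 0)"
      by (simp add: sum.reindex[OF assms(2)])
    finally show ?thesis using assms(1) by simp
  qed
  show ?thesis
    unfolding s_def[symmetric]
  proof
    assume "\<exists>u. t = s + u"
    then show "f ` A \<subseteq> Poly_Mapping.keys t"
      using lookup_s by (auto simp: in_keys_iff lookup_add)
  next
    assume A: "f ` A \<subseteq> Poly_Mapping.keys t"
    have "t = s + (t - s)"
      using A by (intro poly_mapping_eqI) (auto simp: lookup_s lookup_add lookup_minus in_keys_iff)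
    then show "\<exists>u. t = s + u" by blast
  qed
qed

lemma prod_single:
  "(\<Prod>i\<in>A. Poly_Mapping.single (s i) (c i)) =
    Poly_Mapping.single (\<Sum>i\<in>A. s i) (\<Prod>i\<in>A. c i :: 'a :: comm_semiring_1)"
  by (induction A rule: infinite_finite_induct) (simp_all add: mult_single)

lemma poly_mapping_sum_single:
  "p = (\<Sum>t\<in>Poly_Mapping.keys p. Poly_Mapping.single t (Poly_Mapping.lookup p t))"
proof (rule poly_mapping_eqI)
  fix x
  show "Poly_Mapping.lookup p x = Poly_Mapping.lookup
      (\<Sum>t\<in>Poly_Mapping.keys p. Poly_Mapping.single t (Poly_Mapping.lookup p t)) x"
    by (auto simp: lookup_sum lookup_single when_def in_keys_iff sum.delta)
qed

text \<open>
  The polynomials satisfying the right-hand side form an ideal because a monomial of a product is a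
  product of monomials. Conversely, such a polynomial is the sum of its terms, each of which is a multiple
  of a generator; the cofactor stays in the ring since its indeterminates occur in the
  polynomial. Arbitrary nonzero coefficients are allowed on the generators to absorb the signs of the minors.
\<close>
lemma genideal_terms:
  fixes s :: "'i \<Rightarrow> (nat \<times> nat) \<Rightarrow>\<^sub>0 nat" and c :: "'i \<Rightarrow> 'a :: field"
  defines "g \<equiv> \<lambda>a. Poly_Mapping.single (s a) (c a)"
  assumes nz: "\<And>a. a \<in> A \<Longrightarrow> c a \<noteq> 0"
    and carr: "\<And>a. a \<in> A \<Longrightarrow> Poly_Mapping.keys (s a) \<subseteq> {(i, j). {i, j} \<in> E}"
  shows "p \<in> genideal (edge_poly_ring E) (g ` A) \<longleftrightarrow>
    p \<in> carrier (edge_poly_ring E) \<and> (\<forall>t\<in>Poly_Mapping.keys p. \<exists>a\<in>A. \<exists>u. t = s a + u)"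
proof -
  let ?R = "edge_poly_ring E :: 'a edge_poly ring"
  let ?J = "{p \<in> carrier ?R. \<forall>t\<in>Poly_Mapping.keys p. \<exists>a\<in>A. \<exists>u. t = s a + u}"
  interpret R: cring ?R by (rule edge_poly_ring_cring)
  have [simp]: "mult ?R = (*)" "one ?R = 1" "zero ?R = 0" "add ?R = (+)"
    by (simp_all add: edge_poly_ring_def)
  have mem: "p \<in> carrier ?R \<longleftrightarrow>
      (\<forall>t\<in>Poly_Mapping.keys p. Poly_Mapping.keys t \<subseteq> {(i, j). {i, j} \<in> E})" for p
    by (auto simp: edge_poly_ring_def)
  have gR: "g ` A \<subseteq> carrier ?R"
    using carr nz by (auto simp: mem g_def)
  have uminus: "\<ominus>\<^bsub>?R\<^esub> p = - p" if "p \<in> carrier ?R" for p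
    using that by (intro R.minus_equality) (auto simp: mem)
  have J: "ideal ?J ?R"
  proof (rule idealI)
    show "subgroup ?J (add_monoid ?R)"
    proof (rule R.add.subgroupI)
      show "?J \<noteq> {}" using R.zero_closed by force
    next
      fix p assume "p \<in> ?J"
      then show "\<ominus>\<^bsub>?R\<^esub> p \<in> ?J"
        using R.a_inv_closed[of p] by (simp add: uminus)
    next
      fix p q assume pq: "p \<in> ?J" "q \<in> ?J"
      then show "p \<oplus>\<^bsub>?R\<^esub> q \<in> ?J"
        using R.a_closed[of p q] Poly_Mapping.keys_add[of p q] by auto
    qed auto
  next
    fix p q assume p: "p \<in> ?J" and q: "q \<in> carrier ?R"
    have "\<exists>a\<in>A. \<exists>u. t = s a + u" if t: "t \<in> Poly_Mapping.keys (q * p)" for t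
    proof -
      obtain x y where xy: "t = x + y" "y \<in> Poly_Mapping.keys p"
        using t Poly_Mapping.keys_mult[of q p] by blast
      then obtain a u where "a \<in> A" "y = s a + u" using p by blast
      then have "t = s a + (x + u)" using xy by (simp add: add_ac)
      with \<open>a \<in> A\<close> show ?thesis by blast
    qed
    then show "q \<otimes>\<^bsub>?R\<^esub> p \<in> ?J"
      using p q R.m_closed[of q p] by simp
    then show "p \<otimes>\<^bsub>?R\<^esub> q \<in> ?J"
      by (simp add: mult.commute)
  qed (rule R.ring_axioms)
  have "g ` A \<subseteq> ?J"
    using gR by (fastforce simp: g_def split: if_splits intro: exI[of _ 0])
  then have 1: "genideal ?R (g ` A) \<subseteq> ?J"
    using J R.genideal_minimal by blast
  interpret I: ideal "genideal ?R (g ` A)" ?R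
    by (rule R.genideal_ideal[OF gR])
  have sum: "(\<Sum>t\<in>T. f t) \<in> genideal ?R (g ` A)"
    if "\<And>t. t \<in> T \<Longrightarrow> f t \<in> genideal ?R (g ` A)" for T :: "((nat \<times> nat) \<Rightarrow>\<^sub>0 nat) set" and f
    using that
  proof (induction T rule: infinite_finite_induct)
    case (insert x T)
    then show ?case using I.a_closed[of "f x" "sum f T"] by simp
  qed (use I.zero_closed in simp_all)
  have "p \<in> genideal ?R (g ` A)" if p: "p \<in> ?J" for p
  proof -
    have "Poly_Mapping.single t (Poly_Mapping.lookup p t) \<in> genideal ?R (g ` A)"
      if t: "t \<in> Poly_Mapping.keys p" for t
    proof -
      obtain a u where a: "a \<in> A" and u: "t = s a + u" using p t by blast
      let ?q = "Poly_Mapping.single u (Poly_Mapping.lookup p t / c a)"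
      have "Poly_Mapping.keys u \<subseteq> Poly_Mapping.keys t"
        by (auto simp: u in_keys_iff lookup_add)
      then have "?q \<in> carrier ?R"
        using p t by (auto simp: mem split: if_splits)
      moreover have "g a \<in> genideal ?R (g ` A)"
        using R.genideal_self[OF gR] a by blast
      ultimately have "?q * g a \<in> genideal ?R (g ` A)"
        using I.I_l_closed by simp
      then show ?thesis
        using nz[OF a] by (simp add: g_def mult_single u add.commute)
    qed
    then have "(\<Sum>t\<in>Poly_Mapping.keys p. Poly_Mapping.single t (Poly_Mapping.lookup p t))
        \<in> genideal ?R (g ` A)"
      by (rule sum)
    then show ?thesis
      using poly_mapping_sum_single[of p] by simp
  qed
  with 1 show ?thesis by blast
qed

section \<open>The maximal minors\<close>

lemma det_unique_permutation:
  fixes A :: "'a :: comm_ring_1 mat"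
  assumes A: "A \<in> carrier_mat n n" and p: "p permutes {0..<n}"
    and unique: "\<And>q. q permutes {0..<n} \<Longrightarrow> (\<And>k. k < n \<Longrightarrow> A $$ (k, q k) \<noteq> 0) \<Longrightarrow> q = p"
  shows "det A = of_int (sign p) * (\<Prod>k = 0..<n. A $$ (k, p k))"
proof -
  have zero: "of_int (sign q) * (\<Prod>k = 0..<n. A $$ (k, q k)) = 0"
    if "q \<in> {q. q permutes {0..<n}} - {p}" for q
  proof -
    have "\<exists>k<n. A $$ (k, q k) = 0" using unique[of q] that by blast
    then have "(\<Prod>k = 0..<n. A $$ (k, q k)) = 0" by (intro prod_zero) auto
    then show ?thesis by simp
  qed
  have "det A = (\<Sum>q | q permutes {0..<n}. of_int (sign q) * (\<Prod>k = 0..<n. A $$ (k, q k)))"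
    by (rule det_def'[OF A])
  also have "\<dots> = (\<Sum>q\<in>{p}. of_int (sign q) * (\<Prod>k = 0..<n. A $$ (k, q k)))"
    using p zero by (intro sum.mono_neutral_right) (auto simp: finite_permutations)
  finally show ?thesis by simp
qed

lemma bij_betw_pick:
  fixes I :: "nat set"
  shows "bij_betw (pick I) {..<card {a. a < n \<and> a \<in> I}} {a. a < n \<and> a \<in> I}"
proof -
  let ?J = "{a. a < n \<and> a \<in> I}"
  have "inj_on (pick ?J) {..<card ?J}"
  proof (rule linorder_inj_onI)
    fix x y assume "x < y" "x \<in> {..<card ?J}" "y \<in> {..<card ?J}"
    then show "pick ?J x \<noteq> pick ?J y" using pick_mono[of y ?J x] by simp
  qed auto
  moreover have "pick ?J ` {..<card ?J} \<subseteq> ?J"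
    using pick_in_set[of _ ?J] by blast
  ultimately have "bij_betw (pick ?J) {..<card ?J} ?J"
    using card_subset_eq[of ?J "pick ?J ` {..<card ?J}"] card_image[of "pick ?J" "{..<card ?J}"]
    by (simp add: bij_betw_def)
  then show ?thesis
    by (rule bij_betw_cong[THEN iffD1, rotated]) (simp add: pick_reduce_set)
qed

lemma tree_mat_incident:
  assumes "k < m" "c \<le> m" "es ! k = {Suc c, y}" "Suc c \<noteq> y"
  shows "tree_mat m es $$ (k, c) =
    Poly_Mapping.single (Poly_Mapping.single (Suc c, y) 1) (if Suc c < y then -1 else 1)"
  using assms by (auto simp: tree_mat_def Let_def X_def single_uminus min_def max_def)

lemma tree_mat_not_incident:
  assumes "k < m" "c \<le> m" "card (es ! k) = 2" "Suc c \<notin> es ! k"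
  shows "tree_mat m es $$ (k, c) = 0"
proof -
  have "finite (es ! k)" "es ! k \<noteq> {}"
    using assms(3) by (auto intro: card_ge_0_finite)
  then have "Suc c \<noteq> Min (es ! k)" "Suc c \<noteq> Max (es ! k)"
    using assms(4) Min_in Max_in by metis+
  then show ?thesis
    using assms(1,2) by (simp add: tree_mat_def Let_def)
qed

text \<open>
  The minor \<open>v\<^sub>r\<close> is a nonzero constant times the product of the \<open>x\<^bsub>i b(i, r)\<^esub>\<close> over \<open>i \<noteq> r\<close>: a permutation
  without zero entries is a matching of edges with endpoints other than \<open>r\<close>, and the
  only such matching assigns to each edge its endpoint farther from \<open>r\<close>, here called \<open>child\<close>.
\<close>
lemma tree_minor_eq_term:
  fixes es :: "nat set list"
  assumes tree: "is_tree {1..m + 1} E" and es: "distinct es" "set es = E"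
    and r: "r \<in> {1..m + 1}"
  shows "\<exists>c. c \<noteq> 0 \<and> (tree_minor m es r :: 'a::field edge_poly) =
    Poly_Mapping.single (\<Sum>i\<in>{1..m + 1} - {r}. Poly_Mapping.single (i, tree_b E i r) 1) c"
proof -
  interpret finite_tree "{1..m + 1}" E by unfold_locales (rule tree)
  let ?V = "{1..m + 1} - {r}"
  let ?J = "- {r - 1}"
  define parent_edge where "parent_edge = (\<lambda>i. {i, tree_b E i r})"
  define child where "child = inv_into ?V parent_edge"
  define vert where "vert = (\<lambda>c. Suc (pick ?J c))"
  define B where "B = (submatrix (tree_mat m es) UNIV ?J :: 'a edge_poly mat)"
  have parent_bij: "bij_betw parent_edge ?V E"
    using bij_betw_parent_edge[OF r] by (simp add: parent_edge_def)
  then have child_bij: "bij_betw child E ?V"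
    unfolding child_def by (rule bij_betw_inv_into)
  have parent_child: "parent_edge (child e) = e" if "e \<in> E" for e
    unfolding child_def using parent_bij that by (rule bij_betw_inv_into_right)
  have child_parent: "child (parent_edge i) = i" if "i \<in> ?V" for i
    unfolding child_def using parent_bij that by (rule bij_betw_inv_into_left)
  have len: "length es = m"
    using bij_betw_same_card[OF parent_bij] distinct_card[OF es(1)] es(2) r by simp
  then have rows: "bij_betw ((!) es) {0..<m} E"
    using bij_betw_nth[OF es(1), of "{0..<m}" E] es(2) by (simp add: atLeast0LessThan)
  have columns: "{c. c < m + 1 \<and> c \<in> ?J} = {0..<m + 1} - {r - 1}"
    by auto
  then have card_columns: "card {c. c < m + 1 \<and> c \<in> ?J} = m"
    using r by (subst columns) (simp add: card_Diff_singleton_if; arith)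
  have vert_bij: "bij_betw vert {0..<m} ?V"
  proof -
    have "bij_betw (pick ?J) {0..<m} ({0..<m + 1} - {r - 1})"
      using bij_betw_pick[of ?J "m + 1", unfolded card_columns]
      unfolding columns lessThan_atLeast0 .
    moreover have "Suc ` ({0..<m + 1} - {r - 1}) = ?V"
      using r by (auto simp: image_set_diff[OF inj_Suc] image_Suc_atLeastLessThan)
    then have "bij_betw Suc ({0..<m + 1} - {r - 1}) ?V"
      by (simp add: bij_betw_def)
    ultimately have "bij_betw (Suc \<circ> pick ?J) {0..<m} ?V"
      by (rule bij_betw_trans)
    then show ?thesis by (simp add: vert_def comp_def)
  qed
  have dims: "dim_row (tree_mat m es :: 'a edge_poly mat) = m"
    "dim_col (tree_mat m es :: 'a edge_poly mat) = m + 1"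
    by (simp_all add: tree_mat_def)
  have B: "B \<in> carrier_mat m m"
    unfolding B_def carrier_mat_def using card_columns by (simp add: dim_submatrix dims)
  have B_entry: "B $$ (k, c) = tree_mat m es $$ (k, pick ?J c)" if "k < m" "c < m" for k c
    unfolding B_def using that card_columns by (subst submatrix_index) (simp_all add: dims pick_UNIV)
  have pick_le: "pick ?J c \<le> m" if "c < m" for c
    using bij_betwE[OF vert_bij] that by (auto simp: vert_def)
  have edge: "es ! k \<in> E" if "k < m" for k
    using bij_betwE[OF rows] that by simp
  have incident: "vert c \<in> es ! k" if "k < m" "c < m" "B $$ (k, c) \<noteq> 0" for k c
    using that B_entry[of k c] tree_mat_not_incident[of k m "pick ?J c" es] pick_le[of c]
      edge_card[OF edge[of k]] by (auto simp: vert_def)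
  (* The surviving permutation: row k goes to the column of the child endpoint of the edge of row k. *)
  define p where "p = (\<lambda>k. if k < m then inv_into {0..<m} vert (child (es ! k)) else k)"
  have p_bij: "bij_betw p {0..<m} {0..<m}"
  proof -
    have "bij_betw (inv_into {0..<m} vert \<circ> (child \<circ> (!) es)) {0..<m} {0..<m}"
      using bij_betw_trans[OF bij_betw_trans[OF rows child_bij] bij_betw_inv_into[OF vert_bij]] .
    then show ?thesis
      by (rule bij_betw_cong[THEN iffD1, rotated]) (simp add: p_def)
  qed
  then have p: "p permutes {0..<m}"
    by (rule bij_imp_permutes) (simp add: p_def)
  have child_in: "child (es ! k) \<in> ?V" if "k < m" for k
    using bij_betwE[OF child_bij] edge[OF that] by blast
  have vert_p: "vert (p k) = child (es ! k)" if "k < m" for k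
    using bij_betw_inv_into_right[OF vert_bij child_in[OF that]] that by (simp add: p_def)
  have unique: "q = p"
    if q: "q permutes {0..<m}" and nz: "\<And>k. k < m \<Longrightarrow> B $$ (k, q k) \<noteq> 0" for q
  proof
    fix k
    have q_bij: "bij_betw q {0..<m} {0..<m}" using q by (rule permutes_imp_bij)
    (* The permutation q, read as a map g from edges to vertices, is a matching. *)
    define row where "row = inv_into {0..<m} ((!) es)"
    define g where "g = vert \<circ> (q \<circ> row)"
    have g_bij: "bij_betw g E ?V"
      unfolding g_def row_def
      using bij_betw_trans[OF bij_betw_trans[OF bij_betw_inv_into[OF rows] q_bij] vert_bij] .
    have row_es: "row (es ! k) = k" if "k < m" for k
      unfolding row_def using bij_betw_inv_into_left[OF rows] that by simp
    have g_es: "g (es ! k) = vert (q k)" if "k < m" for k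
      using row_es[OF that] by (simp add: g_def)
    have "g e \<in> e - {r}" if e: "e \<in> E" for e
    proof -
      obtain k where k: "k < m" "e = es ! k"
        using rows e by (auto simp: bij_betw_def)
      then have "q k < m" using bij_betwE[OF q_bij] by simp
      then have "g e \<in> e" using incident[of k "q k"] nz k g_es by simp
      then show ?thesis using bij_betwE[OF g_bij] e by blast
    qed
    then have matching: "g (parent_edge i) = i" if "i \<in> ?V" for i
      unfolding parent_edge_def
      using edge_matching_unique[OF r bij_betw_imp_inj_on[OF g_bij]] that by blast
    show "q k = p k"
    proof (cases "k < m")
      case True
      then have "vert (q k) = vert (p k)"
        using matching[OF child_in] parent_child[OF edge] g_es vert_p by simp
      moreover have "q k \<in> {0..<m}" "p k \<in> {0..<m}"
        using True bij_betwE[OF q_bij] bij_betwE[OF p_bij] by simp_all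
      ultimately show ?thesis
        using bij_betw_imp_inj_on[OF vert_bij] by (simp add: inj_on_eq_iff)
    next
      case False
      then show ?thesis using permutes_not_in[OF q] permutes_not_in[OF p] by simp
    qed
  qed
  define e where "e = (\<lambda>i. if i < tree_b E i r then -1 else 1 :: 'a)"
  have entry: "B $$ (k, p k) = Poly_Mapping.single
      (Poly_Mapping.single (child (es ! k), tree_b E (child (es ! k)) r) 1) (e (child (es ! k)))"
    if k: "k < m" for k
  proof -
    let ?i = "child (es ! k)"
    have pk: "p k < m" using bij_betwE[OF p_bij] k by simp
    have i: "Suc (pick ?J (p k)) = ?i" using vert_p[OF k] by (simp add: vert_def)
    have ek: "es ! k = {?i, tree_b E ?i r}"
      using parent_child[OF edge[OF k]] by (simp add: parent_edge_def)
    then have "?i \<noteq> tree_b E ?i r" using edge[OF k] edge_neq by metis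
    with ek show ?thesis
      using tree_mat_incident[OF k pick_le[OF pk], of es "tree_b E ?i r"]
      unfolding i B_entry[OF k pk] by (simp add: e_def)
  qed
  let ?s = "\<Sum>i\<in>?V. Poly_Mapping.single (i, tree_b E i r) (1 :: nat)"
  let ?c = "\<Prod>k = 0..<m. e (child (es ! k))"
  have "tree_minor m es r = of_int (sign p) * (\<Prod>k = 0..<m. B $$ (k, p k))"
    unfolding tree_minor_def B_def[symmetric] using det_unique_permutation[OF B p unique] .
  also have "(\<Prod>k = 0..<m. B $$ (k, p k)) = Poly_Mapping.single
      (\<Sum>k = 0..<m. Poly_Mapping.single (child (es ! k), tree_b E (child (es ! k)) r) 1) ?c"
    using entry by (simp add: prod_single)
  also have "(\<Sum>k = 0..<m. Poly_Mapping.single (child (es ! k), tree_b E (child (es ! k)) r) 1) = ?s"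
    using sum.reindex_bij_betw[OF bij_betw_trans[OF rows child_bij],
        of "\<lambda>i. Poly_Mapping.single (i, tree_b E i r) (1 :: nat)"] by simp
  also have "of_int (sign p) * Poly_Mapping.single ?s ?c = Poly_Mapping.single ?s (of_int (sign p) * ?c)"
    by (simp add: mult_single flip: single_of_int)
  finally have "tree_minor m es r = Poly_Mapping.single ?s (of_int (sign p) * ?c)" .
  moreover have "of_int (sign p) * ?c \<noteq> 0"
    by (simp add: sign_def e_def)
  ultimately show ?thesis by blast
qed

section \<open>The prime decomposition\<close>

theorem proposition1p4:
  fixes m :: nat and E :: "nat set set" and es :: "nat set list"
  assumes "m \<ge> 1"
    and "is_tree {1..m + 1} E"
    and "distinct es" and "set es = E"
  shows "(generic_monomial_ideal m es :: 'a::field edge_poly set) =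
    (\<Inter>(i, j) \<in> {(i, j). 1 \<le> i \<and> i < j \<and> j \<le> m + 1}.
       genideal (edge_poly_ring E) {X i (tree_b E i j), X j (tree_e E i j)})"
proof -
  interpret finite_tree "{1..m + 1}" E by unfold_locales (rule assms(2))
  let ?V = "{1..m + 1}" and ?R = "edge_poly_ring E :: 'a edge_poly ring"
  let ?pairs = "{(i, j). 1 \<le> i \<and> i < j \<and> j \<le> m + 1}"
  let ?s = "\<lambda>r. \<Sum>i\<in>?V - {r}. Poly_Mapping.single (i, tree_b E i r) (1 :: nat)"
  have divides_iff: "(\<exists>u. t = ?s r + u) \<longleftrightarrow> (\<forall>i\<in>?V - {r}. (i, tree_b E i r) \<in> Poly_Mapping.keys t)"
    for t r
    using exists_add_sum_single_iff[of "?V - {r}" "\<lambda>i. (i, tree_b E i r)" t]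
    by (auto simp: inj_on_def)
  have minors: "p \<in> generic_monomial_ideal m es \<longleftrightarrow> p \<in> carrier ?R \<and>
      (\<forall>t\<in>Poly_Mapping.keys p. \<exists>r\<in>?V. \<forall>i\<in>?V - {r}. (i, tree_b E i r) \<in> Poly_Mapping.keys t)"
    for p :: "'a edge_poly"
  proof -
    have "\<forall>r\<in>?V. \<exists>c. c \<noteq> 0 \<and> (tree_minor m es r :: 'a edge_poly) = Poly_Mapping.single (?s r) c"
      using tree_minor_eq_term[OF assms(2-4)] by blast
    from bchoice[OF this] obtain c where c: "\<And>r. r \<in> ?V \<Longrightarrow> c r \<noteq> 0"
      "\<And>r. r \<in> ?V \<Longrightarrow> (tree_minor m es r :: 'a edge_poly) = Poly_Mapping.single (?s r) (c r)"
      by blast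
    have "Poly_Mapping.keys (?s r) \<subseteq> {(i, j). {i, j} \<in> E}" if "r \<in> ?V" for r
      using keys_sum[of "\<lambda>i. Poly_Mapping.single (i, tree_b E i r) (1 :: nat)" "?V - {r}"]
        tree_b_edge[OF _ that] by fastforce
    from genideal_terms[of ?V c ?s E p, OF c(1) this] show ?thesis
      unfolding generic_monomial_ideal_def assms(4) divides_iff using c(2)
      by (simp cong: image_cong_simp)
  qed
  have prime: "p \<in> genideal ?R {X i (tree_b E i j), X j (tree_e E i j)} \<longleftrightarrow> p \<in> carrier ?R \<and>
      (\<forall>t\<in>Poly_Mapping.keys p.
        (i, tree_b E i j) \<in> Poly_Mapping.keys t \<or> (j, tree_b E j i) \<in> Poly_Mapping.keys t)"
    if ij: "(i, j) \<in> ?pairs" for p :: "'a edge_poly" and i j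
  proof -
    let ?A = "{(i, tree_b E i j), (j, tree_b E j i)}"
    let ?x = "\<lambda>d. Poly_Mapping.single d (1 :: nat)"
    have "Poly_Mapping.keys (?x d) \<subseteq> {(i, j). {i, j} \<in> E}" if "d \<in> ?A" for d
      using that ij tree_b_edge[of i j] tree_b_edge[of j i] by auto
    moreover have "(\<exists>u. t = ?x d + u) \<longleftrightarrow> d \<in> Poly_Mapping.keys t" for t :: "(nat \<times> nat) \<Rightarrow>\<^sub>0 nat" and d
      using exists_add_sum_single_iff[of "{d}" id t] by simp
    ultimately have "p \<in> genideal ?R ((\<lambda>d. Poly_Mapping.single (?x d) 1) ` ?A) \<longleftrightarrow>
        p \<in> carrier ?R \<and> (\<forall>t\<in>Poly_Mapping.keys p. \<exists>d\<in>?A. d \<in> Poly_Mapping.keys t)"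
      using genideal_terms[of ?A "\<lambda>_. 1" ?x E p] by simp
    then show ?thesis
      using ij tree_e_eq_tree_b[of i j] by (simp add: X_def)
  qed
  (* The condition on pairs is symmetric, so the restriction i < j is harmless. *)
  have unordered: "(\<forall>i\<in>?V. \<forall>j\<in>?V. i \<noteq> j \<longrightarrow> P i j \<or> P j i) \<longleftrightarrow> (\<forall>(i, j)\<in>?pairs. P i j \<or> P j i)"
    (is "?L \<longleftrightarrow> ?R'") for P :: "nat \<Rightarrow> nat \<Rightarrow> bool"
  proof
    assume L: ?L
    show ?R'
    proof clarify
      fix i j assume "1 \<le> i" "i < j" "j \<le> m + 1" "\<not> P j i"
      then show "P i j" using L[rule_format, of i j] by simp
    qed
  next
    assume R: ?R'
    show ?L
    proof (intro ballI impI)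
      fix i j assume "i \<in> ?V" "j \<in> ?V" "i \<noteq> j"
      then consider "(i, j) \<in> ?pairs" | "(j, i) \<in> ?pairs" by (auto simp: neq_iff)
      then show "P i j \<or> P j i" using R by cases blast+
    qed
  qed
  have common: "(\<exists>r\<in>?V. \<forall>i\<in>?V - {r}. (i, tree_b E i r) \<in> Poly_Mapping.keys t) \<longleftrightarrow>
      (\<forall>(i, j)\<in>?pairs. (i, tree_b E i j) \<in> Poly_Mapping.keys t \<or> (j, tree_b E j i) \<in> Poly_Mapping.keys t)"
    for t
    using common_root_iff[of "Poly_Mapping.keys t"] unordered[of "\<lambda>i j. (i, tree_b E i j) \<in> Poly_Mapping.keys t"]
    by simp
  have intersection: "p \<in> (\<Inter>(i, j)\<in>?pairs. genideal ?R {X i (tree_b E i j), X j (tree_e E i j)}) \<longleftrightarrow>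
      p \<in> carrier ?R \<and> (\<forall>t\<in>Poly_Mapping.keys p. \<forall>(i, j)\<in>?pairs.
        (i, tree_b E i j) \<in> Poly_Mapping.keys t \<or> (j, tree_b E j i) \<in> Poly_Mapping.keys t)"
    (is "_ \<longleftrightarrow> p \<in> carrier ?R \<and> ?M") for p
  proof -
    have "p \<in> (\<Inter>(i, j)\<in>?pairs. genideal ?R {X i (tree_b E i j), X j (tree_e E i j)}) \<longleftrightarrow>
        (\<forall>(i, j)\<in>?pairs. p \<in> genideal ?R {X i (tree_b E i j), X j (tree_e E i j)})"
      by blast
    also have "\<dots> \<longleftrightarrow> (\<forall>(i, j)\<in>?pairs. p \<in> carrier ?R \<and> (\<forall>t\<in>Poly_Mapping.keys p.
        (i, tree_b E i j) \<in> Poly_Mapping.keys t \<or> (j, tree_b E j i) \<in> Poly_Mapping.keys t))"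
      using prime by (intro ball_cong refl) auto
    also have "\<dots> \<longleftrightarrow> p \<in> carrier ?R \<and> ?M"
    proof -
      (* There is at least one pair, so the intersection stays inside the ring. *)
      have "(1, 2) \<in> ?pairs" using assms(1) by simp
      then show ?thesis by blast
    qed
    finally show ?thesis .
  qed
  show ?thesis
  proof (rule Set.set_eqI)
    fix p :: "'a edge_poly"
    show "p \<in> generic_monomial_ideal m es \<longleftrightarrow>
        p \<in> (\<Inter>(i, j)\<in>?pairs. genideal ?R {X i (tree_b E i j), X j (tree_e E i j)})"
      unfolding minors intersection using common by (intro conj_cong ball_cong refl)
  qed
qed

end
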